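(* Let $p$ be a prime number, $n \geq 1$, $e \in E(n)$, and let $P = \bigoplus_{i=1}^n \mathbb{Z}/p^{e_i}\mathbb{Z}$ be the abelian $p$-group of type $e$. Let $\varphi \in \mathrm{Aut}(P)$. Then $$\Pi(\varphi) \geq p^{b(e) + c(e)}.$$
   Context: For an integer $n \geq 1$, $E(n)$ is the set of $e=(e_1,\ldots,e_n)\in\mathbb{Z}^n$ with $1 \leq e_1 \leq e_2 \leq \cdots \leq e_n$. $\Pi$: for a finite abelian $p$-group $P$ (written additively) and $i \in \mathbb{Z}$ coprime with $p$, let $\mu_i \in \mathrm{Aut}(P)$ be given by $\mu_i(x) = ix$. For an automorphism $\psi$, $\mathrm{Fix}(\psi)$ is its set of fixed points. For $\varphi \in \mathrm{Aut}(P)$ put $\Pi(\varphi) = \prod_{i=1}^{p-1} |\mathrm{Fix}(\mu_i \circ \varphi)|$. $abc$-decomposition: given $e \in E(n)$, its entries are decomposed into blocks as follows. Step 1: each maximal constant subsequence (of consecutive entries) of $e_1,\ldots,e_n$ of length at least $2$ forms one block, called an $a$-block. Step 2: among the remaining entries, starting from the left, one looks for successive entries $e_i, e_{i+1}$ (both not yet placed in a block) with $e_{i+1} = e_i + 1$; each such pair forms one block, called a $b$-block (the search is greedy from left to right and each entry belongs to at most one block). Step 3: each remaining entry forms a block by itself, called a $c$-block. The numbers of $a$-, $b$- and $c$-blocks are denoted $a(e)$, $b(e)$, $c(e)$. *)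

theory Defs
  imports "HOL-Algebra.Algebra" "HOL-Computational_Algebra.Primes"
begin

hide_const (open) Divisibility.prime

text \<open>A sequence $(e_1,\dots,e_n)$ is a list, so that $e_i$ is \<open>e ! (i - 1)\<close>; blocks are sets of
  (zero-based) positions rather than of values. The entries are positive, so they are taken to be
  natural numbers.\<close>

definition E :: "nat \<Rightarrow> nat list set" where
  "E n = {e. length e = n \<and> sorted e \<and> (\<forall>x\<in>set e. 1 \<le> x)}"

definition a_blocks :: "nat list \<Rightarrow> nat set set" where
  "a_blocks e = {{i..j} | i j. i < j \<and> j < length e \<and> (\<forall>k\<in>{i..j}. e ! k = e ! i) \<and>
     (0 < i \<longrightarrow> e ! (i - 1) \<noteq> e ! i) \<and> (j + 1 < length e \<longrightarrow> e ! (j + 1) \<noteq> e ! j)}"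

text \<open>\<open>b_search e R i\<close> is the greedy left-to-right search for \<open>b\<close>-blocks among the positions in
  \<open>R\<close>, started at position \<open>i\<close>; it continues behind a pair once that pair has been found.\<close>

function b_search :: "nat list \<Rightarrow> nat set \<Rightarrow> nat \<Rightarrow> nat set set" where
  "b_search e R i =
     (if i + 1 < length e then
        if i \<in> R \<and> i + 1 \<in> R \<and> e ! (i + 1) = e ! i + 1
        then insert {i, i + 1} (b_search e R (i + 2))
        else b_search e R (i + 1)
      else {})"
  by pat_completeness auto
termination by (relation "measure (\<lambda>(e, R, i). length e - i)") auto

declare b_search.simps [simp del]

definition b_blocks :: "nat list \<Rightarrow> nat set set" where
  "b_blocks e = b_search e ({..<length e} - \<Union>(a_blocks e)) 0"

definition c_blocks :: "nat list \<Rightarrow> nat set set" where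
  "c_blocks e = {{i} | i. i \<in> {..<length e} - \<Union>(a_blocks e) - \<Union>(b_blocks e)}"

definition abelian_p_group :: "nat \<Rightarrow> nat list \<Rightarrow> (nat \<Rightarrow> int) monoid" where
  "abelian_p_group p e = sum_group {..<length e} (\<lambda>i. integer_mod_group (p ^ (e ! i)))"

text \<open>Groups are written multiplicatively in \<open>HOL-Algebra\<close>, so the multiple $ix$ is a power. The
  restriction to the carrier is what membership in \<^const>\<open>auto\<close>, the library's set of
  automorphisms, demands.\<close>

definition mu :: "('a, 'b) monoid_scheme \<Rightarrow> int \<Rightarrow> 'a \<Rightarrow> 'a" where
  "mu G i = (\<lambda>x\<in>carrier G. x [^]\<^bsub>G\<^esub> i)"

definition Fix :: "('a, 'b) monoid_scheme \<Rightarrow> ('a \<Rightarrow> 'a) \<Rightarrow> 'a set" where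
  "Fix G \<psi> = {x \<in> carrier G. \<psi> x = x}"

definition Pi_fix :: "nat \<Rightarrow> ('a, 'b) monoid_scheme \<Rightarrow> ('a \<Rightarrow> 'a) \<Rightarrow> nat" where
  "Pi_fix p G \<phi> = (\<Prod>i = 1..p - 1. card (Fix G (compose (carrier G) (mu G (int i)) \<phi>)))"

end

theory Submission
  imports Defs
begin

text \<open>The fixed points of $\psi = i\varphi$ are the kernel of $\delta = \psi - 1$. If $\delta$ maps a
  subset $B$ of $P$ into a set $A$, then $|B| \le |A| \cdot |\mathrm{Fix}(\psi)|$, because the fibres
  of $\delta$ have at most $|\mathrm{Fix}(\psi)|$ elements. So it suffices to find $A$ and $B$ with
  a large quotient $|B|/|A|$.

  Call a set $V$ of entries of $e$ sparse if it contains no two consecutive integers, and suppose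
  that every value in $V$ occurs only once in $e$. An endomorphism of $P$ is given by an integer
  matrix $(d_{ij})$ whose entry $d_{ij}$ is divisible by $p^{e_i - e_j}$ whenever $e_i \ge e_j$. Put
  $t(k) = |\{v \in V : v < k\}|$ and $u(k) = |\{v \in V : v \le k\}|$, and let
  $B = \bigoplus p^{t(e_i)} \mathbb{Z}/p^{e_i}$ and $A = \bigoplus p^{u(e_i)} \mathbb{Z}/p^{e_i}$.
  Then $|B|/|A| = p^{|V|}$, and sparseness makes every off-diagonal entry of the matrix map
  $B$ into $A$: for $k < l$ one has $u(k) \le t(l)$ and $u(l) \le t(k) + (l - k)$ (lemma
  \<open>below_Suc_sparse\<close>). A diagonal entry $d_{jj}$ of $\delta$ with $e_j \in V$ must gain one factor $p$, which it does exactly if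
  $p$ divides it (\<open>displacement_in_layer\<close>, \<open>card_Fix_ge\<close>).

  If $\varphi$ is an automorphism, its diagonal entry at a value of multiplicity one is
  invertible modulo $p$ (\<open>diagonal_entry_unit\<close>), because it is the scalar by which $\varphi$
  acts on a one-dimensional quotient of the filtration of the socle of $P$ by its intersections
  with the subgroups $p^k P$. Hence each $v \in V$ is captured by some $i \in \{1, \dots, p-1\}$: the one for which the diagonal entry of
  $i\varphi$ is $1$ modulo $p$. Subsets of sparse sets are sparse, so the bounds for the single
  $i$ multiply to $\Pi(\varphi) \ge p^{|V|}$ (\<open>Pi_fix_ge\<close>).

  Finally the first entries of the $b$-blocks together with the $c$-blocks form such a set $V$ with
  exactly $b(e) + c(e)$ elements (\<open>sparse_representatives\<close>): the greedy search
  puts the left one of two adjacent successive free entries into a pair, and only the first entry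
  of a pair is kept.\<close>

section \<open>Counting fixed points\<close>

text \<open>If $\psi(x) x^{-1} = \psi(y) y^{-1}$, then $y^{-1} x$ is a fixed point of $\psi$; so a fibre of the
  displacement $x \mapsto \psi(x) x^{-1}$ is no larger than the set of fixed points.\<close>

lemma (in group) card_le_displacement_times_Fix:
  assumes \<psi>: "\<psi> \<in> hom G G" and B: "B \<subseteq> carrier G" and fin: "finite (carrier G)" "finite A"
    and disp: "\<And>x. x \<in> B \<Longrightarrow> \<psi> x \<otimes> inv x \<in> A"
  shows "card B \<le> card A * card (Fix G \<psi>)"
proof -
  interpret group_hom G G \<psi>
    by unfold_locales (use \<psi> in auto)
  define f where "f x = \<psi> x \<otimes> inv x" for x
  have fib: "card {x \<in> B. f x = a} \<le> card (Fix G \<psi>)" for a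
  proof (cases "\<exists>y\<in>B. f y = a")
    case True
    then obtain y where y: "y \<in> B" "f y = a" by blast
    then have yG: "y \<in> carrier G" using B by auto
    show ?thesis
    proof (rule card_inj_on_le[of "\<lambda>x. inv y \<otimes> x"])
      show "inj_on (\<lambda>x. inv y \<otimes> x) {x \<in> B. f x = a}"
        using B yG by (auto simp: inj_on_def subset_iff)
      show "finite (Fix G \<psi>)"
        using fin by (auto simp: Fix_def)
      show "(\<lambda>x. inv y \<otimes> x) ` {x \<in> B. f x = a} \<subseteq> Fix G \<psi>"
      proof clarify
        fix x assume x: "x \<in> B" "a = f x"
        then have xG: "x \<in> carrier G" using B by auto
        have eq: "\<psi> x \<otimes> inv x = \<psi> y \<otimes> inv y" using x y by (simp add: f_def)
        have "\<psi> x = \<psi> x \<otimes> inv x \<otimes> x" using xG by (simp add: m_assoc)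
        also have "\<dots> = \<psi> y \<otimes> (inv y \<otimes> x)" using xG yG by (simp add: eq m_assoc)
        finally have "inv (\<psi> y) \<otimes> \<psi> x = inv y \<otimes> x" using xG yG
          by (simp add: inv_solve_left' m_assoc)
        then show "inv y \<otimes> x \<in> Fix G \<psi>" using xG yG by (simp add: Fix_def)
      qed
    qed
  next
    case False
    then have "{x \<in> B. f x = a} = {}" by auto
    then show ?thesis by (simp only: card.empty)
  qed
  have finB: "finite B" using B fin finite_subset by blast
  have "B = (\<Union>a\<in>A. {x \<in> B. f x = a})" using disp by (auto simp: f_def)
  then have "card B \<le> (\<Sum>a\<in>A. card {x \<in> B. f x = a})"
    using card_UN_le[OF fin(2), of "\<lambda>a. {x \<in> B. f x = a}"] by simp
  also have "\<dots> \<le> card A * card (Fix G \<psi>)"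
    using sum_bounded_above[of A "\<lambda>a. card {x \<in> B. f x = a}" "card (Fix G \<psi>)"] fib by simp
  finally show ?thesis .
qed

section \<open>Sparse sets of values\<close>

definition below :: "nat set \<Rightarrow> nat \<Rightarrow> nat" where
  "below V k = card {v \<in> V. v < k}"

lemma below_le: "below V k \<le> k"
proof -
  have "card {v \<in> V. v < k} \<le> card {..<k}" by (rule card_mono) auto
  then show ?thesis by (simp add: below_def)
qed

lemma below_Suc_le:
  assumes "0 \<notin> V" shows "below V (Suc k) \<le> k"
proof -
  have "card {v \<in> V. v < Suc k} \<le> card {1..k}"
    by (rule card_mono) (use assms not_less_eq_eq in \<open>force+\<close>)
  then show ?thesis by (simp add: below_def)
qed

lemma below_mono: "k \<le> l \<Longrightarrow> below V k \<le> below V l"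
  unfolding below_def by (rule card_mono) auto

lemma below_Suc: "below V (Suc k) = below V k + (if k \<in> V then 1 else 0)"
proof -
  have "{v \<in> V. v < Suc k} = (if k \<in> V then insert k {v \<in> V. v < k} else {v \<in> V. v < k})"
    by (auto simp: less_Suc_eq)
  then show ?thesis by (simp add: below_def)
qed

text \<open>The interval from $k$ to $l$ has $l - k + 1$ elements, and a sparse set misses at least one of them
  as soon as $k < l$.\<close>
lemma below_Suc_sparse:
  assumes sparse: "\<And>v. v \<in> V \<Longrightarrow> Suc v \<notin> V" and "k < l"
  shows "below V (Suc l) \<le> below V k + (l - k)"
proof -
  have "below V (Suc (k + d + 1)) \<le> below V k + (d + 1)" for d
  proof (induction d)
    case 0 show ?case using sparse[of k] by (simp add: below_Suc)
  next
    case (Suc d) then show ?case using below_Suc[of V "k + Suc d + 1"] by auto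
  qed
  from this[of "l - k - 1"] \<open>k < l\<close> show ?thesis by simp
qed

section \<open>Endomorphisms of abelian p-groups as integer matrices\<close>

text \<open>Below, the integer \<open>\<phi> (unit j) i\<close> serves as the matrix entry $d_{ij}$ of an endomorphism
  \<open>\<phi>\<close>.\<close>

locale p_group_of_type =
  fixes p :: nat and e :: "nat list"
  assumes prime_p: "prime p"
begin

abbreviation P :: "(nat \<Rightarrow> int) monoid" where "P \<equiv> abelian_p_group p e"

abbreviation q :: "nat \<Rightarrow> int" where "q i \<equiv> int p ^ (e ! i)"

lemma q_pos: "q i > 0"
  using prime_p by (simp add: prime_gt_0_nat)

lemma group_P: "group P"
  by (simp add: abelian_p_group_def)

sublocale P: group P by (rule group_P)

lemma carrier_P: "carrier P = (\<Pi>\<^sub>E i\<in>{..<length e}. {0..<q i})"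
proof -
  have "p ^ k \<noteq> 0" for k using prime_p by (simp add: prime_gt_0_nat)
  then have "carrier (integer_mod_group (p ^ (e ! i))) = {0..<q i}" for i
    by (simp add: carrier_integer_mod_group)
  then show ?thesis by (auto simp: abelian_p_group_def carrier_sum_group)
qed

lemma finite_carrier_P: "finite (carrier P)"
  unfolding carrier_P by (rule finite_PiE) auto

lemma P_eqI:
  assumes "x \<in> carrier P" "y \<in> carrier P" "\<And>i. i < length e \<Longrightarrow> x i = y i"
  shows "x = y"
  using assms unfolding carrier_P by (intro PiE_ext) auto

lemma mult_nth: "i < length e \<Longrightarrow> (x \<otimes>\<^bsub>P\<^esub> y) i = (x i + y i) mod q i"
  by (simp add: abelian_p_group_def)

lemma one_nth: "i < length e \<Longrightarrow> \<one>\<^bsub>P\<^esub> i = 0"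
  by (simp add: abelian_p_group_def)

lemma mod_nth: "x \<in> carrier P \<Longrightarrow> i < length e \<Longrightarrow> x i mod q i = x i"
  by (auto simp: carrier_P PiE_iff)

lemma projection_hom:
  assumes "i < length e"
  shows "(\<lambda>x. x i) \<in> hom P (integer_mod_group (p ^ (e ! i)))"
  using assms by (auto simp: hom_def abelian_p_group_def carrier_sum_group PiE_iff)

lemma pow_nth:
  fixes k :: int
  assumes "x \<in> carrier P" "i < length e"
  shows "(x [^]\<^bsub>P\<^esub> k) i = k * x i mod q i"
  using hom_int_pow[OF projection_hom[OF assms(2)] assms(1) group_P group_integer_mod_group, of k]
  by (simp add: int_pow_integer_mod_group)

lemma inv_nth:
  assumes "x \<in> carrier P" "i < length e"
  shows "(inv\<^bsub>P\<^esub> x) i = - x i mod q i"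
  using pow_nth[OF assms, of "-1"] assms by (simp add: P.int_pow_neg P.int_pow_1)

definition cls :: "(nat \<Rightarrow> int) \<Rightarrow> nat \<Rightarrow> int" where
  "cls v = (\<lambda>i\<in>{..<length e}. v i mod q i)"

lemma cls_closed: "cls v \<in> carrier P"
  using q_pos by (auto simp: carrier_P cls_def)

lemma cls_nth: "i < length e \<Longrightarrow> cls v i = v i mod q i"
  by (simp add: cls_def)

definition unit :: "nat \<Rightarrow> nat \<Rightarrow> int" where
  "unit j = cls (\<lambda>i. if i = j then 1 else 0)"

lemma unit_closed: "unit j \<in> carrier P"
  by (simp add: unit_def cls_closed)

lemma unit_nth: "i < length e \<Longrightarrow> unit j i = (if i = j then 1 else 0) mod q i"
  by (simp add: unit_def cls_nth)

lemma endomorphism_expansion: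
  assumes \<phi>: "\<phi> \<in> hom P P" and x: "x \<in> carrier P" and i: "i < length e"
  shows "q i dvd \<phi> x i - (\<Sum>j<length e. \<phi> (unit j) i * x j)"
proof -
  \<comment> \<open>Additivity only speaks of sums of two elements, so the coordinates of \<open>x\<close> are switched on one
    at a time.\<close>
  define trunc where "trunc m = cls (\<lambda>i. if i < m then x i else 0)" for m
  have tc: "trunc m \<in> carrier P" for m by (simp add: trunc_def cls_closed)
  have "q i dvd \<phi> (trunc m) i - (\<Sum>j<m. \<phi> (unit j) i * x j)" if "m \<le> length e" for m
    using that
  proof (induction m)
    case 0
    have "trunc 0 = \<one>\<^bsub>P\<^esub>"
      by (rule P_eqI) (auto simp: tc one_nth, simp add: trunc_def cls_nth)
    then show ?case using hom_one[OF \<phi> group_P group_P] i by (simp add: one_nth)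
  next
    case (Suc m)
    have "trunc (Suc m) = trunc m \<otimes>\<^bsub>P\<^esub> unit m [^]\<^bsub>P\<^esub> x m"
    proof (rule P_eqI)
      fix k assume k: "k < length e"
      show "trunc (Suc m) k = (trunc m \<otimes>\<^bsub>P\<^esub> unit m [^]\<^bsub>P\<^esub> x m) k"
        using k by (cases k m rule: linorder_cases)
          (simp_all add: mult_nth pow_nth unit_closed trunc_def cls_nth unit_nth mod_simps)
    qed (auto simp: tc unit_closed)
    then have "\<phi> (trunc (Suc m)) = \<phi> (trunc m) \<otimes>\<^bsub>P\<^esub> \<phi> (unit m) [^]\<^bsub>P\<^esub> x m"
      using hom_mult[OF \<phi> tc, of "unit m [^]\<^bsub>P\<^esub> x m" m]
        hom_int_pow[OF \<phi> unit_closed group_P group_P] unit_closed by simp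
    then have "\<phi> (trunc (Suc m)) i = (\<phi> (trunc m) i + x m * \<phi> (unit m) i) mod q i"
      using i hom_in_carrier[OF \<phi> unit_closed] by (simp add: mult_nth pow_nth mod_simps)
    then have "q i dvd \<phi> (trunc (Suc m)) i - (\<phi> (trunc m) i + x m * \<phi> (unit m) i)"
      by (simp add: mod_eq_dvd_iff[symmetric])
    from dvd_add[OF this Suc.IH] Suc.prems show ?case
      by (simp add: algebra_simps)
  qed
  moreover have "trunc (length e) = x"
    by (rule P_eqI) (auto simp: tc x, simp add: trunc_def cls_nth mod_nth x)
  ultimately show ?thesis by (metis order_refl)
qed

text \<open>The $j$-th generator is killed by $p^{e_j}$, hence so is its image. For $e_i < e_j$ the exponent is truncated
  to $0$.\<close>
lemma entry_divisible:
  assumes \<phi>: "\<phi> \<in> hom P P" and i: "i < length e"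
  shows "int p ^ (e ! i - e ! j) dvd \<phi> (unit j) i"
proof (cases "e ! j \<le> e ! i")
  case True
  have "unit j [^]\<^bsub>P\<^esub> q j = \<one>\<^bsub>P\<^esub>"
    by (rule P_eqI) (auto simp: unit_closed one_nth pow_nth unit_nth mod_simps)
  then have "\<phi> (unit j) [^]\<^bsub>P\<^esub> q j = \<one>\<^bsub>P\<^esub>"
    using hom_int_pow[OF \<phi> unit_closed group_P group_P] hom_one[OF \<phi> group_P group_P] by metis
  then have "q j * \<phi> (unit j) i mod q i = 0"
    using pow_nth[OF hom_in_carrier[OF \<phi> unit_closed] i] one_nth[OF i] by metis
  then have "q i dvd q j * \<phi> (unit j) i" by auto
  moreover have "q i = q j * int p ^ (e ! i - e ! j)"
    using True by (simp flip: power_add)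
  ultimately show ?thesis using q_pos[of j] by auto
qed simp

text \<open>Otherwise $\varphi$ would move the element $p^{e_j - 1}$ of the $j$-th summand, which does not lie in
  $p^{e_j} P$, into $p^{e_j} P$: the coordinates of its image vanish where $e_i < e_j$ and are divisible
  by $p^{e_i - 1}$ where $e_i > e_j$. An automorphism cannot do that.\<close>
lemma diagonal_entry_unit:
  assumes \<phi>: "\<phi> \<in> hom P P" and bij: "bij_betw \<phi> (carrier P) (carrier P)"
    and j: "j < length e" and pos: "e ! j \<ge> 1"
    and single: "\<And>i. i < length e \<Longrightarrow> e ! i = e ! j \<Longrightarrow> i = j"
  shows "\<not> int p dvd \<phi> (unit j) j"
proof
  assume dvd: "int p dvd \<phi> (unit j) j"
  define r where "r = int p ^ (e ! j - 1)"
  have qj: "q j = r * int p" using pos by (simp add: r_def power_eq_if mult.commute)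
  \<comment> \<open>Modulo \<open>q i\<close>, each coordinate of the image of \<open>r\<close> times the generator is a multiple of \<open>q j\<close>.\<close>
  have div: "\<exists>w. q i dvd r * \<phi> (unit j) i - q j * w" if i: "i < length e" for i
  proof -
    consider "i = j" | "e ! i < e ! j" | "e ! i > e ! j"
      using single[OF i] by (cases "e ! i" "e ! j" rule: linorder_cases) auto
    then show ?thesis
    proof cases
      case 1
      then have "q i dvd r * \<phi> (unit j) i - q j * 0" using dvd by (simp add: qj mult_dvd_mono)
      then show ?thesis by blast
    next
      case 2
      then have "q i dvd r" by (auto simp: r_def intro!: le_imp_power_dvd)
      then have "q i dvd r * \<phi> (unit j) i - q j * 0" by simp
      then show ?thesis by blast
    next
      case 3
      have "int p ^ (e ! i - e ! j) dvd \<phi> (unit j) i" by (rule entry_divisible[OF \<phi> i])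
      moreover have "int p dvd int p ^ (e ! i - e ! j)" using 3 by auto
      ultimately obtain w where "\<phi> (unit j) i = int p * w" by (meson dvd_def dvd_trans)
      then have "q i dvd r * \<phi> (unit j) i - q j * w" by (simp add: qj)
      then show ?thesis by blast
    qed
  qed
  then obtain w where w: "\<And>i. i < length e \<Longrightarrow> q i dvd r * \<phi> (unit j) i - q j * w i"
    by metis
  obtain z where z: "z \<in> carrier P" "\<phi> z = cls w"
    using bij cls_closed by (metis bij_betw_iff_bijections)
  have "\<phi> (unit j [^]\<^bsub>P\<^esub> r) = \<phi> (z [^]\<^bsub>P\<^esub> q j)"
  proof (rule P_eqI)
    fix i assume i: "i < length e"
    show "\<phi> (unit j [^]\<^bsub>P\<^esub> r) i = \<phi> (z [^]\<^bsub>P\<^esub> q j) i"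
      using w[OF i] i hom_in_carrier[OF \<phi> unit_closed] z
      by (simp add: hom_int_pow[OF \<phi> _ group_P group_P] unit_closed pow_nth cls_closed cls_nth
          mod_simps mod_eq_dvd_iff)
  qed (auto intro!: hom_in_carrier[OF \<phi>] simp: unit_closed z)
  then have "unit j [^]\<^bsub>P\<^esub> r = z [^]\<^bsub>P\<^esub> q j"
    using bij z(1) unit_closed by (auto simp: bij_betw_def dest!: inj_onD)
  then have "(unit j [^]\<^bsub>P\<^esub> r) j = (z [^]\<^bsub>P\<^esub> q j) j" by simp
  then have "q j dvd r"
    using j z by (simp add: pow_nth unit_closed unit_nth mod_simps dvd_eq_mod_eq_0)
  moreover have "r > 0" "r < q j"
    using prime_p prime_gt_1_nat[OF prime_p] by (auto simp: r_def qj)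
  ultimately show False using zdvd_not_zless by blast
qed

section \<open>Fixed points from sparse values\<close>

definition layer :: "(nat \<Rightarrow> nat) \<Rightarrow> (nat \<Rightarrow> int) set" where
  "layer t = (\<Pi>\<^sub>E i\<in>{..<length e}. {x \<in> {0..<q i}. int p ^ t (e ! i) dvd x})"

lemma layer_subset: "layer t \<subseteq> carrier P"
  unfolding layer_def carrier_P by (intro PiE_mono) auto

lemma card_multiples_below_power:
  assumes "s \<le> k"
  shows "card {x \<in> {0..<int p ^ k}. int p ^ s dvd x} = p ^ (k - s)"
proof -
  have pos: "int p ^ s > 0" using prime_p by (simp add: prime_gt_0_nat)
  have k: "int p ^ k = int p ^ s * int p ^ (k - s)" using assms by (simp flip: power_add)
  have "{x \<in> {0..<int p ^ k}. int p ^ s dvd x} = (\<lambda>y. int p ^ s * y) ` {0..<int p ^ (k - s)}"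
  proof (intro equalityI subsetI)
    fix x assume "x \<in> {x \<in> {0..<int p ^ k}. int p ^ s dvd x}"
    then obtain y where y: "x = int p ^ s * y" and "0 \<le> x" "x < int p ^ k" by (auto elim: dvdE)
    then have "0 \<le> y" "y < int p ^ (k - s)" using pos by (simp_all add: k zero_le_mult_iff)
    then show "x \<in> (\<lambda>y. int p ^ s * y) ` {0..<int p ^ (k - s)}" unfolding y by (intro imageI) simp
  next
    fix x assume "x \<in> (\<lambda>y. int p ^ s * y) ` {0..<int p ^ (k - s)}"
    then obtain y where "x = int p ^ s * y" "0 \<le> y" "y < int p ^ (k - s)"
      by (elim imageE) (simp only: atLeastLessThan_iff)
    then show "x \<in> {x \<in> {0..<int p ^ k}. int p ^ s dvd x}" using pos by (simp add: k)
  qed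
  moreover have "inj_on (\<lambda>y. int p ^ s * y) {0..<int p ^ (k - s)}"
    using pos by (auto simp: inj_on_def)
  ultimately show ?thesis by (simp add: card_image nat_power_eq)
qed

lemma card_layer:
  assumes "\<And>k. t k \<le> k"
  shows "card (layer t) = p ^ (\<Sum>i<length e. e ! i - t (e ! i))"
  by (simp only: layer_def card_PiE finite_lessThan card_multiples_below_power assms power_sum)

text \<open>For the entry in row $i$ and column $j$ it has to be checked that $d_{ij} p^{t(e_j)}$ is divisible by
  $p^{u(e_i)}$. Where $e_i < e_j$ this is $u(e_i) \le t(e_j)$; where $e_i = e_j$ off the diagonal, the
  value is not in $V$ and $t = u$ there; where $e_i > e_j$, the factor $p^{e_i - e_j}$ of the entry makes
  up for the growth of $u$, by sparseness. On the diagonal, $d_{ii} - 1$ supplies the missing factor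
  $p$ at the values in $V$.\<close>
lemma displacement_in_layer:
  assumes \<psi>: "\<psi> \<in> hom P P" and V0: "0 \<notin> V"
    and sparse: "\<And>v. v \<in> V \<Longrightarrow> Suc v \<notin> V"
    and single: "\<And>i j. i < length e \<Longrightarrow> j < length e \<Longrightarrow> e ! j \<in> V \<Longrightarrow> e ! i = e ! j \<Longrightarrow> i = j"
    and diag: "\<And>j. j < length e \<Longrightarrow> e ! j \<in> V \<Longrightarrow> int p dvd \<psi> (unit j) j - 1"
    and x: "x \<in> layer (below V)"
  shows "\<psi> x \<otimes>\<^bsub>P\<^esub> inv\<^bsub>P\<^esub> x \<in> layer (\<lambda>k. below V (Suc k))"
proof -
  have xP: "x \<in> carrier P" using x layer_subset by blast
  have xj: "int p ^ below V (e ! j) dvd x j" if "j < length e" for j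
    using x that by (auto simp: layer_def)
  let ?y = "\<psi> x \<otimes>\<^bsub>P\<^esub> inv\<^bsub>P\<^esub> x"
  have yP: "?y \<in> carrier P" using xP hom_in_carrier[OF \<psi>] by auto
  have "int p ^ below V (Suc (e ! i)) dvd ?y i" if i: "i < length e" for i
  proof -
    let ?u = "int p ^ below V (Suc (e ! i))"
    let ?d = "\<lambda>j. \<psi> (unit j) i"
    have off: "?u dvd ?d j * x j" if j: "j < length e" "j \<noteq> i" for j
    proof -
      have "int p ^ (e ! i - e ! j) * int p ^ below V (e ! j) dvd ?d j * x j"
        by (intro mult_dvd_mono entry_divisible \<psi> i xj j)
      moreover have "below V (Suc (e ! i)) \<le> e ! i - e ! j + below V (e ! j)"
      proof (cases "e ! i" "e ! j" rule: linorder_cases)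
        case less
        then show ?thesis using below_mono[of "Suc (e ! i)" "e ! j" V] by simp
      next
        case equal
        then have "e ! i \<notin> V" using single[OF j(1) i _ equal[symmetric]] j(2) by blast
        then show ?thesis using equal by (simp add: below_Suc)
      next
        case greater
        then show ?thesis using below_Suc_sparse[OF sparse greater] by simp
      qed
      then have "?u dvd int p ^ (e ! i - e ! j) * int p ^ below V (e ! j)"
        by (simp only: power_add[symmetric] le_imp_power_dvd)
      ultimately show ?thesis by (rule dvd_trans[rotated])
    qed
    have on: "?u dvd (?d i - 1) * x i"
    proof (cases "e ! i \<in> V")
      case True
      then have "int p * int p ^ below V (e ! i) dvd (?d i - 1) * x i"
        using diag[OF i] xj[OF i] by (intro mult_dvd_mono)
      then show ?thesis using True by (simp add: below_Suc)
    next
      case False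
      then show ?thesis using xj[OF i] by (simp add: below_Suc)
    qed
    \<comment> \<open>Only because \<open>?u\<close> divides the modulus can the divisibility be tested on integer
      representatives.\<close>
    have uq: "?u dvd q i" by (intro le_imp_power_dvd below_Suc_le V0)
    have "(\<Sum>j<length e. ?d j * x j) - x i
        = (\<Sum>j\<in>{..<length e} - {i}. ?d j * x j) + (?d i - 1) * x i"
      using i by (subst sum.remove[of _ i]) (auto simp: algebra_simps)
    also have "?u dvd \<dots>"
      by (intro dvd_add dvd_sum on off) auto
    finally have "?u dvd (\<Sum>j<length e. ?d j * x j) - x i" .
    moreover have "?u dvd \<psi> x i - (\<Sum>j<length e. ?d j * x j)"
      using endomorphism_expansion[OF \<psi> xP i] uq dvd_trans by blast
    ultimately have "?u dvd (\<psi> x i - (\<Sum>j<length e. ?d j * x j)) + ((\<Sum>j<length e. ?d j * x j) - x i)"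
      by (intro dvd_add)
    then have "?u dvd \<psi> x i - x i" by simp
    moreover have "?y i = (\<psi> x i - x i) mod q i"
      using i xP by (simp add: mult_nth inv_nth mod_simps)
    ultimately show ?thesis using uq by (simp add: dvd_mod)
  qed
  then show ?thesis using yP by (auto simp: layer_def carrier_P PiE_iff)
qed

lemma card_Fix_ge:
  assumes \<psi>: "\<psi> \<in> hom P P" and V: "V \<subseteq> set e" "0 \<notin> V"
    and sparse: "\<And>v. v \<in> V \<Longrightarrow> Suc v \<notin> V"
    and single: "\<And>i j. i < length e \<Longrightarrow> j < length e \<Longrightarrow> e ! j \<in> V \<Longrightarrow> e ! i = e ! j \<Longrightarrow> i = j"
    and diag: "\<And>j. j < length e \<Longrightarrow> e ! j \<in> V \<Longrightarrow> int p dvd \<psi> (unit j) j - 1"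
  shows "p ^ card V \<le> card (Fix P \<psi>)"
proof -
  let ?t = "below V" and ?u = "\<lambda>k. below V (Suc k)"
  let ?I = "{i \<in> {..<length e}. e ! i \<in> V}"
  have p1: "p \<ge> 1" using prime_p prime_ge_1_nat by blast
  have "V \<subseteq> (!) e ` ?I"
  proof
    fix v assume "v \<in> V"
    then obtain i where "i < length e" "e ! i = v" using V(1) by (metis in_set_conv_nth subsetD)
    then show "v \<in> (!) e ` ?I" using \<open>v \<in> V\<close> by blast
  qed
  then have cV: "card V \<le> card ?I" by (rule surj_card_le[rotated]) simp
  have "e ! i - ?t (e ! i) = (e ! i - ?u (e ! i)) + (if e ! i \<in> V then 1 else 0)" for i
    using below_Suc_le[OF V(2), of "e ! i"] by (simp add: below_Suc)
  then have "(\<Sum>i<length e. e ! i - ?t (e ! i))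
      = (\<Sum>i<length e. e ! i - ?u (e ! i)) + (\<Sum>i<length e. if e ! i \<in> V then 1 else 0)"
    by (simp add: sum.distrib)
  also have "(\<Sum>i<length e. if e ! i \<in> V then 1 else 0) = card ?I"
    by (simp add: sum.If_cases Int_def)
  finally have "p ^ card V * card (layer ?u) \<le> card (layer ?t)"
    using cV p1
    by (simp add: card_layer below_le below_Suc_le V(2) power_add power_increasing)
  also have "\<dots> \<le> card (layer ?u) * card (Fix P \<psi>)"
  proof (rule P.card_le_displacement_times_Fix[OF \<psi> layer_subset finite_carrier_P])
    show "finite (layer ?u)" using finite_subset[OF layer_subset finite_carrier_P] .
    show "\<psi> x \<otimes>\<^bsub>P\<^esub> inv\<^bsub>P\<^esub> x \<in> layer ?u" if "x \<in> layer ?t" for x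
      by (rule displacement_in_layer[OF \<psi> V(2) sparse single diag that])
  qed
  finally show ?thesis
    using p1 by (simp add: card_layer below_Suc_le V(2) mult.commute)
qed

text \<open>Each value in $V$ contributes a factor $p$ to the fixed points of $i\varphi$ for one inverse $i$ of
  its diagonal entry modulo $p$, and the factors of one $i$ accumulate because a subset of a sparse
  set is sparse.\<close>
lemma Pi_fix_ge:
  assumes \<phi>: "\<phi> \<in> auto P" and V: "V \<subseteq> set e" "0 \<notin> V"
    and sparse: "\<And>v. v \<in> V \<Longrightarrow> Suc v \<notin> V"
    and single: "\<And>i j. i < length e \<Longrightarrow> j < length e \<Longrightarrow> e ! j \<in> V \<Longrightarrow> e ! i = e ! j \<Longrightarrow> i = j"
  shows "p ^ card V \<le> Pi_fix p P \<phi>"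
proof -
  have hom: "\<phi> \<in> hom P P" and bij: "bij_betw \<phi> (carrier P) (carrier P)"
    using \<phi> by (auto simp: auto_def Bij_def)
  have finV: "finite V" using V(1) finite_subset by blast
  define W where "W i = {v \<in> V. \<forall>j<length e. e ! j = v \<longrightarrow> int p dvd int i * \<phi> (unit j) j - 1}" for i
  have "p ^ card (W i) \<le> card (Fix P (compose (carrier P) (mu P (int i)) \<phi>))" for i
  proof (rule card_Fix_ge)
    let ?\<psi> = "compose (carrier P) (mu P (int i)) \<phi>"
    have \<psi>: "?\<psi> x = \<phi> x [^]\<^bsub>P\<^esub> int i" if "x \<in> carrier P" for x
      using that hom_in_carrier[OF hom] by (simp add: compose_def mu_def)
    show "?\<psi> \<in> hom P P"
    proof (rule homI)
      fix x y assume xy: "x \<in> carrier P" "y \<in> carrier P"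
      show "?\<psi> x \<in> carrier P" using xy hom_in_carrier[OF hom] by (simp add: \<psi>)
      show "?\<psi> (x \<otimes>\<^bsub>P\<^esub> y) = ?\<psi> x \<otimes>\<^bsub>P\<^esub> ?\<psi> y"
        by (rule P_eqI) (use xy hom_in_carrier[OF hom] hom_mult[OF hom] in
            \<open>auto simp: \<psi> mult_nth pow_nth mod_simps distrib_left\<close>)
    qed
    show "int p dvd ?\<psi> (unit j) j - 1" if j: "j < length e" "e ! j \<in> W i" for j
    proof -
      have "?\<psi> (unit j) j = int i * \<phi> (unit j) j mod q j"
        using j hom_in_carrier[OF hom unit_closed] by (simp add: \<psi> unit_closed pow_nth)
      then have "q j dvd ?\<psi> (unit j) j - int i * \<phi> (unit j) j"
        by (simp add: mod_eq_dvd_iff[symmetric])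
      moreover have "int p dvd q j" using j V(2) by (auto simp: W_def intro!: dvd_power)
      ultimately have "int p dvd ?\<psi> (unit j) j - int i * \<phi> (unit j) j" using dvd_trans by blast
      moreover have "int p dvd int i * \<phi> (unit j) j - 1" using j by (auto simp: W_def)
      ultimately have "int p dvd (?\<psi> (unit j) j - int i * \<phi> (unit j) j) + (int i * \<phi> (unit j) j - 1)"
        by (rule dvd_add)
      then show ?thesis by simp
    qed
  qed (use V sparse single in \<open>auto simp: W_def\<close>)
  then have "(\<Prod>i = 1..p - 1. p ^ card (W i)) \<le> Pi_fix p P \<phi>"
    unfolding Pi_fix_def by (intro prod_mono) auto
  moreover have "card V \<le> (\<Sum>i = 1..p - 1. card (W i))"
  proof -
    have "v \<in> (\<Union>i\<in>{1..p - 1}. W i)" if v: "v \<in> V" for v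
    proof -
      obtain j where j: "j < length e" "e ! j = v" using v V(1) by (metis in_set_conv_nth subsetD)
      let ?a = "\<phi> (unit j) j"
      have p: "int p > 1" using prime_gt_1_nat[OF prime_p] by simp
      have "\<not> int p dvd ?a"
        by (rule diagonal_entry_unit[OF hom bij j(1)]) (use j v V single in \<open>auto intro!: Suc_leI gr0I\<close>)
      then have "coprime (int p) ?a" using prime_p by (simp add: prime_imp_coprime)
      then obtain b c where "b * ?a + c * int p = 1"
        using bezout_int[of ?a "int p"] by (auto simp: coprime_iff_gcd_eq_1 gcd.commute)
      then have "b * ?a - 1 = int p * (- c)" by (simp add: algebra_simps)
      then have b: "int p dvd b * ?a - 1" by simp
      define i where "i = nat (b mod int p)"
      have ib: "int i = b mod int p" using p by (simp add: i_def)
      have "int p dvd (int i - b) * ?a" unfolding ib by (simp add: mod_eq_dvd_iff[symmetric])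
      from dvd_add[OF this b] have i: "int p dvd int i * ?a - 1" by (simp add: algebra_simps)
      have "i \<noteq> 0"
      proof
        assume "i = 0"
        then have "int p dvd 1" using i by simp
        then show False using p by simp
      qed
      moreover have "int i < int p" using p by (simp add: ib)
      moreover have "v \<in> W i" using v i j single by (auto simp: W_def)
      ultimately show ?thesis by (intro UN_I[of i]) auto
    qed
    then have "card V \<le> card (\<Union>i\<in>{1..p - 1}. W i)"
      by (intro card_mono) (auto simp: W_def finV)
    also have "\<dots> \<le> (\<Sum>i = 1..p - 1. card (W i))" by (rule card_UN_le) simp
    finally show ?thesis .
  qed
  ultimately show ?thesis
    using prime_ge_1_nat[OF prime_p] power_increasing[of "card V" "\<Sum>i = 1..p - 1. card (W i)" p]
    by (simp add: power_sum)
qed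

end

section \<open>Block decomposition\<close>

text \<open>In a sorted list the positions of one value form an interval; if there are at least two of them,
  that interval is an $a$-block.\<close>
lemma unique_outside_a_blocks:
  assumes "sorted e" and i: "i < length e" "i \<notin> \<Union>(a_blocks e)" and j: "j < length e" "e ! j = e ! i"
  shows "j = i"
proof (rule ccontr)
  assume "j \<noteq> i"
  define M where "M = {k. k < length e \<and> e ! k = e ! i}"
  have M: "finite M" "i \<in> M" "j \<in> M" using i j by (auto simp: M_def)
  have mem: "Min M \<in> M" "Max M \<in> M" using M Min_in Max_in by (metis empty_iff)+
  have range: "Min M \<le> k" "k \<le> Max M" if "k \<in> M" for k using M that by auto
  have lt: "Min M < Max M" using range[OF M(2)] range[OF M(3)] \<open>j \<noteq> i\<close> by linarith
  have const: "e ! k = e ! i" if "k \<in> {Min M..Max M}" for k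
    using sorted_nth_mono[OF assms(1), of "Min M" k] sorted_nth_mono[OF assms(1), of k "Max M"] mem that
    by (auto simp: M_def)
  have left: "e ! (Min M - 1) \<noteq> e ! Min M" if "0 < Min M"
  proof
    assume "e ! (Min M - 1) = e ! Min M"
    then have "Min M - 1 \<in> M" using mem(1) by (auto simp: M_def)
    then show False using range(1)[of "Min M - 1"] that by linarith
  qed
  have right: "e ! (Max M + 1) \<noteq> e ! Max M" if "Max M + 1 < length e"
  proof
    assume "e ! (Max M + 1) = e ! Max M"
    then have "Max M + 1 \<in> M" using mem(2) that by (auto simp: M_def)
    then show False using range(2)[of "Max M + 1"] by linarith
  qed
  have "Max M < length e" using mem(2) by (simp add: M_def)
  moreover have "\<forall>k\<in>{Min M..Max M}. e ! k = e ! Min M"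
    using const const[of "Min M"] lt by simp
  ultimately have "{Min M..Max M} \<in> a_blocks e"
    unfolding a_blocks_def mem_Collect_eq using lt left right
    by (intro exI[of _ "Min M"] exI[of _ "Max M"] conjI refl impI)
  then show False using range[OF M(2)] i(2) by auto
qed

lemma b_searchE:
  assumes "B \<in> b_search e R i"
  obtains k where "B = {k, k + 1}" "i \<le> k" "k \<in> R" "k + 1 \<in> R"
  using assms
proof (induction e R i arbitrary: thesis rule: b_search.induct)
  case (1 e R i)
  note step = "1.prems"(2)[unfolded b_search.simps[of e R i]]
  show ?case
  proof (cases "i \<in> R \<and> i + 1 \<in> R \<and> e ! (i + 1) = e ! i + 1")
    case True
    then have "B = {i, i + 1} \<or> i + 1 < length e \<and> B \<in> b_search e R (i + 2)"
      using step by (auto split: if_splits)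
    then show ?thesis
    proof
      assume "i + 1 < length e \<and> B \<in> b_search e R (i + 2)"
      then obtain k where "B = {k, k + 1}" "i + 2 \<le> k" "k \<in> R" "k + 1 \<in> R"
        using "1.IH"(1) True by blast
      then show ?thesis using "1.prems"(1)[of k] by linarith
    qed (use True "1.prems"(1) in blast)
  next
    case False
    then have "i + 1 < length e" "B \<in> b_search e R (i + 1)"
      using step by (auto split: if_splits)
    then obtain k where "B = {k, k + 1}" "i + 1 \<le> k" "k \<in> R" "k + 1 \<in> R"
      using "1.IH"(2) False by blast
    then show ?thesis using "1.prems"(1)[of k] by linarith
  qed
qed

lemma b_search_ge: "{k, k + 1} \<in> b_search e R i \<Longrightarrow> i \<le> k"
  by (elim b_searchE) (auto simp: doubleton_eq_iff)

lemma b_search_disjoint: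
  assumes "{k, k + 1} \<in> b_search e R i" "{k + 1, k + 2} \<in> b_search e R i"
  shows False
  using assms
proof (induction e R i rule: b_search.induct)
  case (1 e R i)
  note step = "1.prems"[unfolded b_search.simps[of e R i]]
  show ?case
  proof (cases "i \<in> R \<and> i + 1 \<in> R \<and> e ! (i + 1) = e ! i + 1")
    case True
    then have len: "i + 1 < length e"
      and "k = i \<or> {k, k + 1} \<in> b_search e R (i + 2)"
        "k + 1 = i \<or> {k + 1, k + 2} \<in> b_search e R (i + 2)"
      using step by (auto split: if_splits simp: doubleton_eq_iff)
    then show ?thesis
      using "1.IH"(1)[OF len True] b_search_ge[of k e R "i + 2"] b_search_ge[of "k + 1" e R "i + 2"]
      by auto
  next
    case False
    then show ?thesis using "1.IH"(2)[OF _ False] step by (auto split: if_splits)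
  qed
qed

text \<open>The search reaches every position that is not the right half of a pair, so a successive pair of
  free entries escapes only if its left entry has already been used.\<close>
lemma b_search_greedy:
  assumes "i \<le> k" "k + 1 < length e" "k \<in> R" "k + 1 \<in> R" "e ! (k + 1) = e ! k + 1"
  shows "k \<in> \<Union>(b_search e R i)"
  using assms
proof (induction e R i rule: b_search.induct)
  case (1 e R i)
  then have len: "i + 1 < length e" by linarith
  note unfold = b_search.simps[of e R i]
  show ?case
  proof (cases "i \<in> R \<and> i + 1 \<in> R \<and> e ! (i + 1) = e ! i + 1")
    case True
    consider "k = i" | "k = i + 1" | "i + 2 \<le> k" using "1.prems"(1) by linarith
    then show ?thesis
    proof cases
      case 3
      then have "k \<in> \<Union>(b_search e R (i + 2))" using "1.IH"(1)[OF len True] "1.prems" by blast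
      then show ?thesis using len True by (simp add: unfold)
    qed (use len True in \<open>simp_all add: unfold\<close>)
  next
    case False
    then have "i + 1 \<le> k" using "1.prems" by (cases "k = i") auto
    then have "k \<in> \<Union>(b_search e R (i + 1))" using "1.IH"(2)[OF len False] "1.prems" by blast
    then show ?thesis unfolding unfold using len False by (simp only: if_True if_False)
  qed
qed

text \<open>The set consists of the values of the left ends of the $b$-blocks and of the $c$-blocks. Two of them
  that were consecutive would stand next to each other, since values outside the $a$-blocks are
  unique. The left one would then have been paired by the greedy search; being a representative, it
  would be the left end of its pair, whose right end is the other representative, and the latter
  neither starts a pair nor is a $c$-block.\<close>
lemma sparse_representatives:
  assumes e: "sorted e"
  obtains V where "V \<subseteq> set e" "card V = card (b_blocks e) + card (c_blocks e)"
    "\<And>v. v \<in> V \<Longrightarrow> Suc v \<notin> V"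
    "\<And>i j. i < length e \<Longrightarrow> j < length e \<Longrightarrow> e ! j \<in> V \<Longrightarrow> e ! i = e ! j \<Longrightarrow> i = j"
proof -
  define R where "R = {..<length e} - \<Union>(a_blocks e)"
  define I where "I = {k. {k, k + 1} \<in> b_blocks e}"
  define C where "C = R - \<Union>(b_blocks e)"
  have bR: "b_blocks e = b_search e R 0" by (simp add: b_blocks_def R_def)
  have IR: "I \<subseteq> R" by (auto simp: I_def bR doubleton_eq_iff elim!: b_searchE)
  have CR: "C \<subseteq> R" by (auto simp: C_def)
  have finR: "finite R" by (simp add: R_def)
  have uniq: "j = i" if "i \<in> R" "j < length e" "e ! j = e ! i" for i j
    using unique_outside_a_blocks[OF e _ _ that(2,3)] that(1) by (auto simp: R_def)
  have b: "b_blocks e = (\<lambda>k. {k, k + 1}) ` I" unfolding I_def bR by (blast elim: b_searchE)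
  have cb: "card (b_blocks e) = card I"
    unfolding b by (rule card_image) (auto simp: inj_on_def doubleton_eq_iff)
  have "c_blocks e = (\<lambda>k. {k}) ` C" by (auto simp: c_blocks_def C_def R_def)
  then have cc: "card (c_blocks e) = card C" by (simp add: card_image)
  have disj: "I \<inter> C = {}" by (auto simp: I_def C_def)
  define V where "V = (!) e ` (I \<union> C)"
  have sub: "I \<union> C \<subseteq> R" using IR CR by auto
  have Rlen: "k < length e" if "k \<in> R" for k using that by (simp add: R_def)
  have "inj_on ((!) e) (I \<union> C)" using uniq sub Rlen by (intro inj_onI) (metis subsetD)
  then have "card V = card (b_blocks e) + card (c_blocks e)"
    unfolding V_def cb cc using disj finite_subset[OF IR finR] finite_subset[OF CR finR]
    by (simp add: card_image card_Un_disjoint)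
  moreover have "V \<subseteq> set e" using sub Rlen by (auto simp: V_def)
  moreover have "Suc v \<notin> V" if "v \<in> V" for v
  proof
    assume "Suc v \<in> V"
    with that obtain k l where k: "k \<in> I \<union> C" "e ! k = v" and l: "l \<in> I \<union> C" "e ! l = Suc v"
      unfolding V_def by (metis imageE)
    have kl: "k \<in> R" "l \<in> R" "k < length e" "l < length e" using k l sub Rlen by auto
    have "k < l" using sorted_nth_mono[OF e, of l k] kl k l by (cases "k < l") auto
    moreover have "\<not> k + 1 < l"
    proof
      assume g: "k + 1 < l"
      then have "e ! k \<le> e ! (k + 1)" "e ! (k + 1) \<le> e ! l"
        using kl by (auto intro!: sorted_nth_mono[OF e])
      then have "e ! (k + 1) = e ! k \<or> e ! (k + 1) = e ! l" using k l by linarith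
      then show False using uniq[of k "k + 1"] uniq[of l "k + 1"] kl g by auto
    qed
    ultimately have lk: "l = k + 1" by simp
    then have "k \<in> \<Union>(b_blocks e)"
      unfolding bR using kl k l by (intro b_search_greedy) auto
    then have kI: "k \<in> I" using k by (auto simp: C_def)
    then have "l \<in> \<Union>(b_blocks e)" using lk by (auto simp: I_def)
    then have "l \<in> I" using l by (auto simp: C_def)
    then show False using kI b_search_disjoint[of k e R 0] lk by (simp add: I_def bR)
  qed
  moreover have "i = j" if "i < length e" "j < length e" "e ! j \<in> V" "e ! i = e ! j" for i j
  proof -
    obtain k where "k \<in> I \<union> C" "e ! j = e ! k" using \<open>e ! j \<in> V\<close> by (auto simp: V_def)
    then show ?thesis using uniq[of k i] uniq[of k j] that sub by auto
  qed
  ultimately show thesis using that by blast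
qed

theorem theorem4p2:
  fixes p n :: nat and e :: "nat list" and \<phi> :: "(nat \<Rightarrow> int) \<Rightarrow> (nat \<Rightarrow> int)"
  assumes "prime p"
    and "n \<ge> 1"
    and "e \<in> E n"
    and "\<phi> \<in> auto (abelian_p_group p e)"
  shows "Pi_fix p (abelian_p_group p e) \<phi> \<ge> p ^ (card (b_blocks e) + card (c_blocks e))"
proof -
  interpret p_group_of_type p e by unfold_locales (rule \<open>prime p\<close>)
  have "sorted e" and pos: "0 \<notin> set e" using \<open>e \<in> E n\<close> by (auto simp: E_def)
  then obtain V where V: "V \<subseteq> set e" "card V = card (b_blocks e) + card (c_blocks e)"
      "\<And>v. v \<in> V \<Longrightarrow> Suc v \<notin> V"
      "\<And>i j. i < length e \<Longrightarrow> j < length e \<Longrightarrow> e ! j \<in> V \<Longrightarrow> e ! i = e ! j \<Longrightarrow> i = j"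
    using sparse_representatives by metis
  have "p ^ card V \<le> Pi_fix p P \<phi>"
    by (rule Pi_fix_ge) (use assms V pos in blast)+
  then show ?thesis by (simp add: V(2))
qed

end
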